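(* Let $G$ be a group and let $A\subset G$ be a subset with $\sigma^R(A)>0$. Then $$\mathrm{cov}(AA^{-1})\le\mathrm{pack}(A)\le\frac1{\sigma^R(A)}.$$
   Context: For a subset $A$ of a group $G$, $\sigma^R(A)=\inf_{F}\sup_{y\in G}\frac{|F\cap Ay|}{|F|}$, where $F$ runs over all non-empty finite subsets of $G$. For a non-empty set $B\subset G$ its covering number is the cardinal $\mathrm{cov}(B)=\min\{|F|:F\subset G,\ G=FB\}$. The packing index of $A$ is $\mathrm{pack}(A)=\sup\{|E|:E\subset G,\ \forall x,y\in E\ (x\ne y\Rightarrow xA\cap yA=\emptyset)\}$. Here $AA^{-1}=\{ab^{-1}:a,b\in A\}$. *)

theory Defs
  imports Complex_Main "HOL-Algebra.Coset"
begin

unbundle cardinal_syntax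

text \<open>Cardinals are represented, as in the library, by cardinal well-orders \<open>|F|\<close> compared by
  \<open>\<le>o\<close>, so they are determined up to order isomorphism. Since \<open>\<le>o\<close> is a well-order up to
  isomorphism, the choice in \<open>min_card\<close> succeeds for every nonempty family.\<close>

definition min_card :: "'a set set \<Rightarrow> 'a rel" where
  "min_card \<F> = (SOME r. r \<in> card_of ` \<F> \<and> (\<forall>F\<in>\<F>. r \<le>o |F| ))"

text \<open>The supremum is the least cardinal bound. It suffices to range over subsets of the ambient
  type, as \<open>|UNIV|\<close> is already a bound and every smaller cardinal is that of some set \<open>S\<close>.\<close>

definition sup_card :: "'a set set \<Rightarrow> 'a rel" where
  "sup_card \<E> = min_card {S. \<forall>E\<in>\<E>. |E| \<le>o |S|}"

text \<open>Comparison of a cardinal with a real number; an infinite cardinal exceeds every real.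
  The well-order \<open>|S|\<close> has field \<open>S\<close>, so a finite cardinal is read off from its field.\<close>

definition cardinal_le_real :: "'a rel \<Rightarrow> real \<Rightarrow> bool" where
  "cardinal_le_real r x \<longleftrightarrow> finite (Field r) \<and> real (card (Field r)) \<le> x"

lemma min_card:
  assumes "\<F> \<noteq> {}"
  shows "\<exists>F\<in>\<F>. min_card \<F> = |F|" and "\<And>F. F \<in> \<F> \<Longrightarrow> min_card \<F> \<le>o |F|"
proof -
  have "\<exists>r\<in>card_of ` \<F>. \<forall>r'\<in>card_of ` \<F>. r \<le>o r'"
    using assms by (intro exists_minim_Card_order) (auto simp: card_of_Card_order)
  then have "\<exists>r. r \<in> card_of ` \<F> \<and> (\<forall>F\<in>\<F>. r \<le>o |F| )"
    by auto
  from someI_ex[OF this]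
  have *: "min_card \<F> \<in> card_of ` \<F> \<and> (\<forall>F\<in>\<F>. min_card \<F> \<le>o |F| )"
    unfolding min_card_def .
  show "\<exists>F\<in>\<F>. min_card \<F> = |F|" and "\<And>F. F \<in> \<F> \<Longrightarrow> min_card \<F> \<le>o |F|"
    using * by auto
qed

lemma sup_card_upper:
  fixes \<E> :: "'a set set"
  assumes "E \<in> \<E>"
  shows "|E| \<le>o sup_card \<E>"
proof -
  have "UNIV \<in> {S :: 'a set. \<forall>E\<in>\<E>. |E| \<le>o |S|}"
    by (simp add: card_of_mono1)
  then have "{S :: 'a set. \<forall>E\<in>\<E>. |E| \<le>o |S|} \<noteq> {}"
    by blast
  from min_card(1)[OF this] show ?thesis
    using assms unfolding sup_card_def by auto
qed

lemma sup_card_least: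
  fixes \<E> :: "'a set set" and r :: "'b rel"
  assumes r: "Card_order r" and le: "\<And>E. E \<in> \<E> \<Longrightarrow> |E| \<le>o r"
  shows "sup_card \<E> \<le>o r"
proof -
  let ?B = "{S :: 'a set. \<forall>E\<in>\<E>. |E| \<le>o |S|}"
  have B: "UNIV \<in> ?B"
    by (simp add: card_of_mono1)
  have rF: "|Field r| =o r"
    using r by (rule card_of_Field_ordIso)
  consider "|UNIV :: 'a set| \<le>o |Field r|" | "|Field r| \<le>o |UNIV :: 'a set|"
    using ordLeq_total[OF card_of_Well_order card_of_Well_order] by blast
  then have "\<exists>S\<in>?B. |S| \<le>o r"
  proof cases
    case 1
    then show ?thesis using B ordLeq_ordIso_trans[OF 1 rF] by blast
  next
    case 2
    then obtain f where f: "inj_on f (Field r)" "f ` Field r \<subseteq> (UNIV :: 'a set)"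
      using card_of_ordLeq[of "Field r" "UNIV :: 'a set"] by blast
    have iso: "|Field r| =o |f ` Field r|"
      using f(1) card_of_ordIsoI[OF inj_on_imp_bij_betw] by blast
    have "r =o |f ` Field r|"
      using ordIso_transitive[OF ordIso_symmetric[OF rF] iso] .
    then show ?thesis
      using le ordLeq_ordIso_trans ordIso_iff_ordLeq by blast
  qed
  then obtain S where S: "S \<in> ?B" "|S| \<le>o r" by blast
  have "sup_card \<E> \<le>o |S|"
    unfolding sup_card_def using min_card(2)[of ?B S] S(1) by blast
  then show ?thesis using S(2) by (rule ordLeq_transitive)
qed

definition sigmaR :: "('a, 'b) monoid_scheme \<Rightarrow> 'a set \<Rightarrow> real" where
  "sigmaR G A =
    (INF F\<in>{F. F \<subseteq> carrier G \<and> finite F \<and> F \<noteq> {}}.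
      SUP y\<in>carrier G. real (card (F \<inter> (A #>\<^bsub>G\<^esub> y))) / real (card F))"

text \<open>Meaningful for nonempty \<open>B \<subseteq> carrier G\<close> only.\<close>

definition cov :: "('a, 'b) monoid_scheme \<Rightarrow> 'a set \<Rightarrow> 'a rel" where
  "cov G B = min_card {F. F \<subseteq> carrier G \<and> carrier G = F <#>\<^bsub>G\<^esub> B}"

definition pack :: "('a, 'b) monoid_scheme \<Rightarrow> 'a set \<Rightarrow> 'a rel" where
  "pack G A = sup_card {E. E \<subseteq> carrier G \<and>
     (\<forall>x\<in>E. \<forall>y\<in>E. x \<noteq> y \<longrightarrow> (x <#\<^bsub>G\<^esub> A) \<inter> (y <#\<^bsub>G\<^esub> A) = {})}"

end

theory Submission
  imports Defs
begin

text \<open>Let \<open>E\<close> be a finite nonempty set whose translates \<open>xA\<close> are pairwise disjoint. Since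
  \<open>x\<^sup>-\<^sup>1 \<in> Ay\<close> is equivalent to \<open>y\<^sup>-\<^sup>1 \<in> xA\<close>, every right translate \<open>Ay\<close> contains at most one
  element of \<open>E\<^sup>-\<^sup>1\<close>, so \<open>E\<^sup>-\<^sup>1\<close>, used as test set in the infimum, gives \<open>\<sigma>\<^sup>R(A) \<le> 1/|E|\<close>.
  Thus \<open>1/\<sigma>\<^sup>R(A)\<close> bounds the size of all finite packings (\<open>sigmaR_le_inverse_card_packing\<close>), and
  hence of all packings, because an infinite one would contain arbitrarily large finite ones
  (\<open>packing_card_bound\<close>).

  Consequently there is a packing \<open>E\<close> of the largest cardinality, and the packing index is
  \<open>|E|\<close>. No \<open>g\<close> outside \<open>E\<close> can be added to \<open>E\<close>, and \<open>A\<close> is nonempty because \<open>\<sigma>\<^sup>R(A) > 0\<close>, so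
  each \<open>gA\<close> meets some \<open>xA\<close> with \<open>x \<in> E\<close>, which puts \<open>g\<close> into \<open>xAA\<^sup>-\<^sup>1\<close>. Hence
  \<open>G = EAA\<^sup>-\<^sup>1\<close> (\<open>maximal_packing_covers\<close>) and the covering number is at most \<open>|E|\<close>.\<close>

definition packing :: "('a, 'b) monoid_scheme \<Rightarrow> 'a set \<Rightarrow> 'a set \<Rightarrow> bool" where
  "packing G A E \<longleftrightarrow> E \<subseteq> carrier G \<and>
     (\<forall>x\<in>E. \<forall>y\<in>E. x \<noteq> y \<longrightarrow> (x <#\<^bsub>G\<^esub> A) \<inter> (y <#\<^bsub>G\<^esub> A) = {})"

lemma packing_subset:
  assumes "packing G A E" and "E' \<subseteq> E"
  shows "packing G A E'"
  using assms unfolding packing_def by (meson subset_eq)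

text \<open>A single test set \<open>F\<close> bounds the infimum from above. Infima and suprema of reals have their
  usual meaning on bounded sets only; here the density quotients lie between \<open>0\<close> and \<open>1\<close>.\<close>

lemma sigmaR_le:
  fixes G :: "('a, 'b) monoid_scheme" and k :: nat
  assumes "group G" and F: "F \<subseteq> carrier G" "finite F" "F \<noteq> {}"
    and k: "\<And>y. y \<in> carrier G \<Longrightarrow> card (F \<inter> (A #>\<^bsub>G\<^esub> y)) \<le> k"
  shows "sigmaR G A \<le> k / card F"
proof -
  interpret group G by fact
  let ?q = "\<lambda>F y. real (card (F \<inter> (A #>\<^bsub>G\<^esub> y))) / real (card F)"
  let ?\<F> = "{F. F \<subseteq> carrier G \<and> finite F \<and> F \<noteq> {}}"
  have sup_nonneg: "0 \<le> (SUP y\<in>carrier G. ?q F y)" if "F \<in> ?\<F>" for F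
  proof -
    have "?q F y \<le> 1" for y
      using that by (auto simp: divide_le_eq_1 card_gt_0_iff intro: card_mono)
    then have "bdd_above (?q F ` carrier G)"
      by (intro bdd_aboveI2)
    then have "?q F \<one>\<^bsub>G\<^esub> \<le> (SUP y\<in>carrier G. ?q F y)"
      by (intro cSUP_upper) auto
    moreover have "0 \<le> ?q F \<one>\<^bsub>G\<^esub>"
      by simp
    ultimately show ?thesis
      by (rule order_trans[rotated])
  qed
  have "sigmaR G A \<le> (SUP y\<in>carrier G. ?q F y)"
    unfolding sigmaR_def using F sup_nonneg by (intro cINF_lower bdd_belowI2) auto
  also have "\<dots> \<le> k / card F"
    using k by (intro cSUP_least) (auto intro!: divide_right_mono)
  finally show ?thesis .
qed

lemma sigmaR_pos_imp_nonempty: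
  fixes G :: "('a, 'b) monoid_scheme"
  assumes "group G" and "sigmaR G A > 0"
  shows "A \<noteq> {}"
proof
  interpret group G by fact
  assume "A = {}"
  then have "sigmaR G A \<le> real 0 / card {\<one>\<^bsub>G\<^esub>}"
    by (intro sigmaR_le) (auto simp: r_coset_def assms(1))
  with assms(2) show False by simp
qed

lemma sigmaR_le_inverse_card_packing:
  fixes G :: "('a, 'b) monoid_scheme"
  assumes "group G" and A: "A \<subseteq> carrier G"
    and E: "packing G A E" "finite E" "E \<noteq> {}"
  shows "sigmaR G A \<le> 1 / card E"
proof -
  interpret group G by fact
  let ?F = "m_inv G ` E"
  have EG: "E \<subseteq> carrier G"
    using E(1) by (simp add: packing_def)
  have card_F: "card ?F = card E"
    by (intro card_image inj_on_subset[OF inv_inj EG])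
  \<comment> \<open>If \<open>x\<^sup>-\<^sup>1, x'\<^sup>-\<^sup>1 \<in> Ay\<close>, then \<open>y\<^sup>-\<^sup>1\<close> is a common element of \<open>xA\<close> and \<open>x'A\<close>.\<close>
  have "card (?F \<inter> (A #>\<^bsub>G\<^esub> y)) \<le> 1" if y: "y \<in> carrier G" for y
  proof -
    have flip: "inv\<^bsub>G\<^esub> y \<in> x <#\<^bsub>G\<^esub> A" if x: "x \<in> E" "inv\<^bsub>G\<^esub> x \<in> A #>\<^bsub>G\<^esub> y" for x
    proof -
      obtain a where a: "a \<in> A" "inv\<^bsub>G\<^esub> x = a \<otimes>\<^bsub>G\<^esub> y"
        using x(2) by (auto simp: r_coset_def)
      have xG: "x \<in> carrier G" and aG: "a \<in> carrier G"
        using x(1) EG a(1) A by auto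
      have "(x \<otimes>\<^bsub>G\<^esub> a) \<otimes>\<^bsub>G\<^esub> y = \<one>\<^bsub>G\<^esub>"
        using xG aG y by (simp add: m_assoc flip: a(2))
      then have "inv\<^bsub>G\<^esub> y = x \<otimes>\<^bsub>G\<^esub> a"
        using xG aG y by (intro inv_equality) auto
      then show ?thesis
        using a(1) by (auto simp: l_coset_def)
    qed
    have "u = v" if uv: "u \<in> ?F \<inter> (A #>\<^bsub>G\<^esub> y)" "v \<in> ?F \<inter> (A #>\<^bsub>G\<^esub> y)" for u v
    proof -
      obtain x x' where x: "x \<in> E" "u = inv\<^bsub>G\<^esub> x" and x': "x' \<in> E" "v = inv\<^bsub>G\<^esub> x'"
        using uv by blast
      have "inv\<^bsub>G\<^esub> y \<in> (x <#\<^bsub>G\<^esub> A) \<inter> (x' <#\<^bsub>G\<^esub> A)"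
        using uv x x' flip by simp
      then have "x = x'"
        using E(1) x(1) x'(1) unfolding packing_def by (metis empty_iff)
      then show ?thesis
        using x x' by simp
    qed
    then show ?thesis
      by (simp add: card_le_Suc0_iff_eq E(2))
  qed
  then have "sigmaR G A \<le> real 1 / card ?F"
    using E EG by (intro sigmaR_le assms(1)) auto
  then show ?thesis
    by (simp add: card_F)
qed

lemma packing_card_bound:
  fixes G :: "('a, 'b) monoid_scheme"
  assumes "group G" and "A \<subseteq> carrier G" and pos: "sigmaR G A > 0"
    and E: "packing G A E"
  shows "finite E" and "card E \<le> 1 / sigmaR G A"
proof -
  have finite_bound: "card E' \<le> 1 / sigmaR G A" if "E' \<subseteq> E" "finite E'" for E'
  proof (cases "E' = {}")
    case False
    then have "sigmaR G A \<le> 1 / card E'"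
      using assms(1,2) packing_subset[OF E that(1)] that(2)
      by (intro sigmaR_le_inverse_card_packing)
    moreover have "card E' > 0"
      using False that(2) by (simp add: card_gt_0_iff)
    ultimately show ?thesis
      using pos by (simp add: field_simps)
  qed (use pos in simp)
  show "finite E"
  proof (rule ccontr)
    assume "infinite E"
    moreover obtain n :: nat where "1 / sigmaR G A < n"
      using reals_Archimedean2 by blast
    ultimately obtain E' where "E' \<subseteq> E" "finite E'" "card E' = n"
      using infinite_arbitrarily_large by blast
    with finite_bound[of E'] \<open>1 / sigmaR G A < n\<close> show False by simp
  qed
  then show "card E \<le> 1 / sigmaR G A"
    using finite_bound by blast
qed

text \<open>If \<open>ga = xb\<close> with \<open>a, b \<in> A\<close>, then \<open>g = x(ba\<^sup>-\<^sup>1)\<close>. For \<open>g \<in> E\<close> one can take \<open>x = g\<close>, as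
  \<open>gA\<close> meets itself when \<open>A\<close> is nonempty.\<close>

lemma maximal_packing_covers:
  fixes G :: "('a, 'b) monoid_scheme"
  assumes "group G" and A: "A \<subseteq> carrier G" "A \<noteq> {}"
    and E: "packing G A E"
    and maximal: "\<And>g. packing G A (insert g E) \<Longrightarrow> g \<in> E"
  shows "carrier G = E <#>\<^bsub>G\<^esub> (A <#>\<^bsub>G\<^esub> (set_inv\<^bsub>G\<^esub> A))"
proof
  interpret group G by fact
  have EG: "E \<subseteq> carrier G"
    using E by (simp add: packing_def)
  show "E <#>\<^bsub>G\<^esub> (A <#>\<^bsub>G\<^esub> (set_inv\<^bsub>G\<^esub> A)) \<subseteq> carrier G"
    using EG A(1) by (intro set_mult_closed) (auto simp: SET_INV_def)
  show "carrier G \<subseteq> E <#>\<^bsub>G\<^esub> (A <#>\<^bsub>G\<^esub> (set_inv\<^bsub>G\<^esub> A))"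
  proof
    fix g assume g: "g \<in> carrier G"
    have "\<exists>x\<in>E. (g <#\<^bsub>G\<^esub> A) \<inter> (x <#\<^bsub>G\<^esub> A) \<noteq> {}"
    proof (cases "g \<in> E")
      case True
      then show ?thesis
        using A(2) by (intro bexI[of _ g]) (auto simp: l_coset_def)
    next
      case False
      then have "\<not> packing G A (insert g E)"
        using maximal by blast
      then show ?thesis
        using E g unfolding packing_def by blast
    qed
    then obtain x a b where x: "x \<in> E" and ab: "a \<in> A" "b \<in> A"
      and eq: "g \<otimes>\<^bsub>G\<^esub> a = x \<otimes>\<^bsub>G\<^esub> b"
      by (auto simp: l_coset_def)
    have G: "x \<in> carrier G" "a \<in> carrier G" "b \<in> carrier G"
      using x ab EG A(1) by auto
    have "g = (g \<otimes>\<^bsub>G\<^esub> a) \<otimes>\<^bsub>G\<^esub> inv\<^bsub>G\<^esub> a"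
      using g G by (simp add: m_assoc)
    also have "\<dots> = x \<otimes>\<^bsub>G\<^esub> (b \<otimes>\<^bsub>G\<^esub> inv\<^bsub>G\<^esub> a)"
      using G by (simp add: eq m_assoc)
    finally show "g \<in> E <#>\<^bsub>G\<^esub> (A <#>\<^bsub>G\<^esub> (set_inv\<^bsub>G\<^esub> A))"
      using x ab unfolding set_mult_def SET_INV_def by blast
  qed
qed

lemma cardinal_le_real_sup_card:
  fixes \<E> :: "'a set set" and S :: "'a set" and c :: real
  assumes "finite S" and "\<And>E. E \<in> \<E> \<Longrightarrow> |E| \<le>o |S|" and "card S \<le> c"
  shows "cardinal_le_real (sup_card \<E>) c"
proof -
  have "S \<in> {S. \<forall>E\<in>\<E>. |E| \<le>o |S|}"
    using assms(2) by simp
  then have "{S :: 'a set. \<forall>E\<in>\<E>. |E| \<le>o |S|} \<noteq> {}"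
    by force
  from min_card(1)[OF this] obtain T where T: "sup_card \<E> = |T|"
    unfolding sup_card_def by (elim bexE)
  have le: "|T| \<le>o |S|"
    unfolding T[symmetric] by (rule sup_card_least[OF card_of_Card_order assms(2)])
  then have "finite T"
    using assms(1) by (rule card_of_ordLeq_finite)
  moreover have "card T \<le> card S"
    using le assms(1) \<open>finite T\<close> by (simp add: inj_on_iff_card_le flip: card_of_ordLeq)
  ultimately show ?thesis
    using assms(3) by (simp add: cardinal_le_real_def T Field_card_of)
qed

theorem proposition12p2:
  fixes G :: "('a, 'b) monoid_scheme" and A :: "'a set"
  assumes "group G" and "A \<subseteq> carrier G" and "sigmaR G A > 0"
  shows "cov G (A <#>\<^bsub>G\<^esub> (set_inv\<^bsub>G\<^esub> A)) \<le>o pack G A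
    \<and> cardinal_le_real (pack G A) (1 / sigmaR G A)"
proof -
  note bound = packing_card_bound[OF assms]
  have pack: "pack G A = sup_card (Collect (packing G A))"
    by (simp add: pack_def packing_def[abs_def])
  \<comment> \<open>The cardinalities of packings are bounded natural numbers, so a largest one exists.\<close>
  have "packing G A {}"
    by (simp add: packing_def)
  moreover have "\<forall>E. packing G A E \<longrightarrow> card E < Suc (nat \<lfloor>1 / sigmaR G A\<rfloor>)"
    using bound(2) by (simp add: less_Suc_eq_le le_nat_floor)
  ultimately obtain E where E: "packing G A E"
    and E_max: "\<And>E'. packing G A E' \<Longrightarrow> card E' \<le> card E"
    using Lattices_Big.ex_has_greatest_nat[of "packing G A" "{}" card] by blast
  have "g \<in> E" if "packing G A (insert g E)" for g
    using E_max[OF that] bound(1)[OF E] by (auto simp: card_insert_if split: if_splits)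
  then have covers: "carrier G = E <#>\<^bsub>G\<^esub> (A <#>\<^bsub>G\<^esub> (set_inv\<^bsub>G\<^esub> A))"
    using assms sigmaR_pos_imp_nonempty[OF assms(1,3)] E
    by (intro maximal_packing_covers)
  have "cov G (A <#>\<^bsub>G\<^esub> (set_inv\<^bsub>G\<^esub> A)) \<le>o |E|"
    unfolding cov_def using E covers by (intro min_card(2)) (auto simp: packing_def)
  also have "|E| \<le>o pack G A"
    unfolding pack using E by (intro sup_card_upper) simp
  finally have "cov G (A <#>\<^bsub>G\<^esub> (set_inv\<^bsub>G\<^esub> A)) \<le>o pack G A" .
  moreover have "cardinal_le_real (pack G A) (1 / sigmaR G A)"
    unfolding pack
  proof (rule cardinal_le_real_sup_card)
    show "|E'| \<le>o |E|" if "E' \<in> Collect (packing G A)" for E'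
      using that E E_max bound(1) by (simp add: inj_on_iff_card_le flip: card_of_ordLeq)
  qed (use bound E in auto)
  ultimately show ?thesis ..
qed

end
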